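(* The following statements hold. (1) $P_4\cap\mathcal R_1=\emptyset$. (2) If $(\omega,\omega',\mathbf v)\in X\smallsetminus(P_4\cup \mathit{NUC})$, then there are integers $m<0$ and $n>0$ for which $\Phi^m(\omega,\omega',\mathbf v)\in\mathcal R_1$ and $\Phi^n(\omega,\omega',\mathbf v)\in\mathcal R_1$. In particular, the first return map $\Phi_R:\mathcal R_1\to\mathcal R_1$ of $\Phi$ to $\mathcal R_1$ is well defined and invertible. (3) If $(\omega,\omega',\mathbf v)\in\mathcal R_1$, then $\rho\circ\Phi_R(\omega,\omega',\mathbf v)=\Phi\circ\rho(\omega,\omega',\mathbf v)$. (4) If $(\omega,\omega',\mathbf v)\in\mathcal R_1$ has a stable periodic orbit of period larger than four, then $\rho(\omega,\omega',\mathbf v)$ has a stable periodic orbit of strictly smaller period.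
   Context: $\Omega_\pm=\{\pm1\}^{\mathbb Z}$ with the product topology, $\sigma(\omega)_n=\omega_{n+1}$, $N=\{(1,0),(0,1),(-1,0),(0,-1)\}$, $X=\Omega_\pm\times\Omega_\pm\times N$. The map $\Phi:X\to X$ is the bijection $$\Phi(\omega,\omega',(a,b))=(\sigma^{sb}(\omega),\sigma^{sa}(\omega'),s(b,a)),\qquad s=\omega_0\omega'_0 .$$ Stable periodic orbits: a point $(\omega,\omega',\mathbf v)\in X$ has a stable periodic orbit of period $n$ if $n$ is the smallest positive integer for which there are open neighborhoods $U$ of $\omega$ and $U'$ of $\omega'$ such that $\Phi^n(\eta,\eta',\mathbf v)=(\eta,\eta',\mathbf v)$ for all $(\eta,\eta')\in U\times U'$. $P_4$ is the set of points of $X$ with a stable periodic orbit of period $4$. Collapsing map: let $S=\{\omega:\omega_0=-1,\omega_1=1\}\cup\{\omega:\omega_{-1}=-1,\omega_0=1\}\subset\Omega_\pm$ and $K(\omega)=\{k\in\mathbb Z:\sigma^k(\omega)\notin S\}$. The sequence $\omega$ is unbounded-collapsible if $K(\omega)$ is unbounded above and below, zero-collapsible if $0\in K(\omega)$, and collapsible if both hold. $C$ is the set of collapsible elements. For $\omega\in C$, index $K(\omega)=\{k_i:i\in\mathbb Z\}$ increasingly with $k_0=0$ and define $c(\omega)\in\Omega_\pm$ by $c(\omega)_i=\omega_{k_i}$. $\mathcal R_1=C\times C\times N$, and $\rho:\mathcal R_1\to X$ is $\rho(\omega,\omega',\mathbf v)=(c(\omega),c(\omega'),\mathbf v)$. $\mathit{NUC}$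 is the set of $(\omega,\omega',\mathbf v)\in X$ such that $\omega$ or $\omega'$ is not unbounded-collapsible. The first return map is $\Phi_R(x)=\Phi^n(x)$ with $n$ the least positive integer such that $\Phi^n(x)\in\mathcal R_1$. *)

theory Defs
  imports "HOL-Analysis.Analysis"
begin

type_synonym seq = "int \<Rightarrow> int"
type_synonym point = "seq \<times> seq \<times> (int \<times> int)"

definition Omega_top :: "seq topology" where
  "Omega_top = product_topology (\<lambda>_. discrete_topology {-1, 1}) UNIV"

definition Omega :: "seq set" where
  "Omega = topspace Omega_top"

definition shift :: "seq \<Rightarrow> seq" where
  "shift w = (\<lambda>n. w (n + 1))"

text \<open>Integer powers of a bijection of \<open>A\<close> onto itself.\<close>

definition int_iter :: "'a set \<Rightarrow> ('a \<Rightarrow> 'a) \<Rightarrow> int \<Rightarrow> 'a \<Rightarrow> 'a" where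
  "int_iter A f k = (if 0 \<le> k then f ^^ nat k else inv_into A f ^^ nat (- k))"

abbreviation shift_pow :: "int \<Rightarrow> seq \<Rightarrow> seq" where
  "shift_pow \<equiv> int_iter Omega shift"

definition N :: "(int \<times> int) set" where
  "N = {(1, 0), (0, 1), (-1, 0), (0, -1)}"

definition X :: "point set" where
  "X = Omega \<times> Omega \<times> N"

fun Phi :: "point \<Rightarrow> point" where
  "Phi (w, w', (a, b)) =
    (let s = w 0 * w' 0 in (shift_pow (s * b) w, shift_pow (s * a) w', (s * b, s * a)))"

abbreviation Phi_pow :: "int \<Rightarrow> point \<Rightarrow> point" where
  "Phi_pow \<equiv> int_iter X Phi"

fun locally_fixed :: "nat \<Rightarrow> point \<Rightarrow> bool" where
  "locally_fixed n (w, w', v) \<longleftrightarrow>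
    (\<exists>U U'. openin Omega_top U \<and> w \<in> U \<and> openin Omega_top U' \<and> w' \<in> U' \<and>
      (\<forall>e\<in>U. \<forall>e'\<in>U'. (Phi ^^ n) (e, e', v) = (e, e', v)))"

definition stable_period :: "point \<Rightarrow> nat \<Rightarrow> bool" where
  "stable_period x n \<longleftrightarrow> x \<in> X \<and> 0 < n \<and> locally_fixed n x \<and>
    (\<forall>m. 0 < m \<and> m < n \<longrightarrow> \<not> locally_fixed m x)"

definition P4 :: "point set" where
  "P4 = {x \<in> X. stable_period x 4}"

definition S :: "seq set" where
  "S = {w \<in> Omega. w 0 = -1 \<and> w 1 = 1} \<union> {w \<in> Omega. w (-1) = -1 \<and> w 0 = 1}"

definition K :: "seq \<Rightarrow> int set" where
  "K w = {k. shift_pow k w \<notin> S}"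

definition unbounded_collapsible :: "seq \<Rightarrow> bool" where
  "unbounded_collapsible w \<longleftrightarrow> \<not> bdd_above (K w) \<and> \<not> bdd_below (K w)"

definition zero_collapsible :: "seq \<Rightarrow> bool" where
  "zero_collapsible w \<longleftrightarrow> 0 \<in> K w"

definition C :: "seq set" where
  "C = {w \<in> Omega. unbounded_collapsible w \<and> zero_collapsible w}"

definition K_index :: "seq \<Rightarrow> int \<Rightarrow> int" where
  "K_index w = (THE k. strict_mono k \<and> range k = K w \<and> k 0 = 0)"

definition collapse :: "seq \<Rightarrow> seq" where
  "collapse w = (\<lambda>i. w (K_index w i))"

definition R1 :: "point set" where
  "R1 = C \<times> C \<times> N"

fun rho :: "point \<Rightarrow> point" where
  "rho (w, w', v) = (collapse w, collapse w', v)"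

definition NUC :: "point set" where
  "NUC = {(w, w', v) \<in> X. \<not> unbounded_collapsible w \<or> \<not> unbounded_collapsible w'}"

definition Phi_R :: "point \<Rightarrow> point" where
  "Phi_R x = (Phi ^^ (LEAST n. 0 < n \<and> (Phi ^^ n) x \<in> R1)) x"

text \<open>The maps whose negative powers are used are bijections of the carriers in question.\<close>

lemma Omega_iff: "w \<in> Omega \<longleftrightarrow> (\<forall>n. w n = -1 \<or> w n = 1)"
  by (auto simp: Omega_def Omega_top_def PiE_iff)

lemma bij_betw_shift: "bij_betw shift Omega Omega"
  by (rule bij_betw_byWitness[where f' = "\<lambda>w n. w (n - 1)"])
    (auto simp: shift_def Omega_iff)

lemma inv_shift:
  assumes "w \<in> Omega"
  shows "inv_into Omega shift w = (\<lambda>n. w (n - 1))"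
proof -
  have "(\<lambda>n. w (n - 1)) \<in> Omega" "shift (\<lambda>n. w (n - 1)) = w"
    using assms by (auto simp: shift_def Omega_iff)
  then show ?thesis
    using bij_betw_shift by (metis bij_betw_def inv_into_f_f)
qed

lemma shift_pow_eq:
  assumes "w \<in> Omega"
  shows "shift_pow k w = (\<lambda>n. w (n + k))"
proof -
  have pos: "(shift ^^ i) w = (\<lambda>n. w (n + int i))" for i
    by (induction i) (auto simp: shift_def algebra_simps)
  have neg: "(inv_into Omega shift ^^ i) w = (\<lambda>n. w (n - int i))" for i
  proof (induction i)
    case (Suc i)
    have "(\<lambda>n. w (n - int i)) \<in> Omega"
      using assms by (auto simp: Omega_iff)
    with Suc show ?case
      by (simp add: inv_shift algebra_simps)
  qed simp
  show ?thesis
    by (simp add: int_iter_def pos neg)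
qed

lemma bij_betw_Phi: "bij_betw Phi X X"
proof (rule bij_betw_byWitness[where f' = "\<lambda>(w, w', (c, d)).
    let s = w (- c) * w' (- d) in ((\<lambda>n. w (n - c)), (\<lambda>n. w' (n - d)), (s * d, s * c))"])
  have sq: "w n * w n = 1" if "w \<in> Omega" for w n
    using that by (metis Omega_iff minus_mult_minus mult_1)
  have sq4: "w n * (w' m * (w n * (w' m * a))) = a" if "w \<in> Omega" "w' \<in> Omega" for w w' n m a
    using sq[OF that(1), of n] sq[OF that(2), of m]
    by (metis mult.assoc mult.left_commute mult_1)
  have sh: "(\<lambda>n. w (n + k)) \<in> Omega" "(\<lambda>n. w (n - k)) \<in> Omega" if "w \<in> Omega" for w k
    using that by (auto simp: Omega_iff)
  have val: "w n * w' m = 1 \<or> w n * w' m = -1" if "w \<in> Omega" "w' \<in> Omega" for w w' n m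
    using that by (metis Omega_iff minus_mult_minus mult_1 mult_minus1_right mult_1_right)
  have N_closed: "(s * b, s * a) \<in> N" if "s = 1 \<or> s = -1" "(a, b) \<in> N" for s a b
    using that by (auto simp: N_def)
  let ?g = "\<lambda>(w, w', (c, d)). let s = w (- c) * w' (- d) in
    ((\<lambda>n. w (n - c)), (\<lambda>n. w' (n - d)), (s * d, s * c)) :: point"
  show "\<forall>x\<in>X. ?g (Phi x) = x"
    by (auto simp: X_def Let_def shift_pow_eq mult.assoc sq4)
  show "\<forall>x\<in>X. Phi (?g x) = x"
    by (auto simp: X_def Let_def shift_pow_eq sh mult.assoc sq4)
  show "Phi ` X \<subseteq> X"
    using N_closed val by (auto simp: X_def Let_def shift_pow_eq sh)
  show "?g ` X \<subseteq> X"
    using N_closed val by (auto simp: X_def Let_def sh)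
qed

end

theory Submission
  imports Defs
begin

text \<open>
  Fix the two sequences and let the point move instead: \<open>\<Phi>\<close> becomes a walk on
  \<open>\<int>\<^sup>2 \<times> N\<close>, and a point has a stable periodic orbit of period \<open>n\<close> iff its walk first
  closes up after \<open>n\<close> steps, since a translation under which all sequences near a given one are
  invariant is trivial.

  Collapsing deletes the disjoint pairs of columns (rows) carrying the signs \<open>-+\<close>. A walk that
  enters a deleted pair of columns along a row which is not deleted crosses the pair in four steps
  and leaves along the same row, so the first return to the undeleted positions is the walk of the
  collapsed sequences. Adjacent deleted positions carry opposite signs, which forces a walk
  that only meets deleted rows and columns to be a loop of length four. Reversing orientation at a tile
  conjugates the walk to its inverse and fixes positions, which gives returns in the past.

  Finally, a walk confined to undeleted positions can reverse its horizontal direction at most once,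
  hence never closes up; so a closed walk meets a deleted position and collapsing shortens it.
\<close>

section \<open>The lattice walk, its symmetries and its section\<close>

definition walk :: "seq \<Rightarrow> seq \<Rightarrow> int \<times> int \<times> int \<times> int \<Rightarrow> int \<times> int \<times> int \<times> int" where
  "walk u u' = (\<lambda>(x, y, a, b). let s = u x * u' y in (x + s * b, y + s * a, s * b, s * a))"

text \<open>The recorded direction is that of arrival. The new one is opposite to the direction in
  which the walk would leave the tile, so this is motion backwards along the same path.\<close>

definition reverse :: "seq \<Rightarrow> seq \<Rightarrow> int \<times> int \<times> int \<times> int \<Rightarrow> int \<times> int \<times> int \<times> int" where
  "reverse u u' = (\<lambda>(x, y, a, b). let s = u x * u' y in (x, y, - s * b, - s * a))"

definition transpose :: "int \<times> int \<times> int \<times> int \<Rightarrow> int \<times> int \<times> int \<times> int" where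
  "transpose = (\<lambda>(x, y, a, b). (y, x, b, a))"

definition kept :: "seq \<Rightarrow> seq \<Rightarrow> (int \<times> int \<times> int \<times> int) set" where
  "kept u u' = K u \<times> K u' \<times> N"

text \<open>Stated for an arbitrary map so that it covers both \<open>Phi\<close> on
  \<open>R1\<close> and the walk on \<open>kept\<close>; it is meaningful only at points that do
  return.\<close>

definition first_return :: "('a \<Rightarrow> 'a) \<Rightarrow> 'a set \<Rightarrow> 'a \<Rightarrow> 'a" where
  "first_return f A x = (f ^^ (LEAST n. 0 < n \<and> (f ^^ n) x \<in> A)) x"

subsection \<open>First return maps\<close>

lemma first_returnI:
  assumes "0 < n" "(f ^^ n) x \<in> A" "\<And>j. 0 < j \<Longrightarrow> j < n \<Longrightarrow> (f ^^ j) x \<notin> A"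
  shows "first_return f A x = (f ^^ n) x"
proof -
  have "(LEAST n. 0 < n \<and> (f ^^ n) x \<in> A) = n"
    by (rule Least_equality) (use assms in \<open>auto simp: not_less[symmetric]\<close>)
  then show ?thesis by (simp add: first_return_def)
qed

lemma first_returnE:
  assumes "0 < m" "(f ^^ m) x \<in> A"
  obtains n where "0 < n" "n \<le> m" "(f ^^ n) x \<in> A" "first_return f A x = (f ^^ n) x"
    "\<And>j. 0 < j \<Longrightarrow> j < n \<Longrightarrow> (f ^^ j) x \<notin> A"
proof -
  let ?P = "\<lambda>n. 0 < n \<and> (f ^^ n) x \<in> A"
  have "?P (LEAST n. ?P n)" by (rule LeastI[of ?P m]) (use assms in auto)
  moreover have "(LEAST n. ?P n) \<le> m" by (rule Least_le) (use assms in auto)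
  moreover have "(f ^^ j) x \<notin> A" if "0 < j" "j < (LEAST n. ?P n)" for j
    using not_less_Least[of j ?P] that by auto
  ultimately show thesis using that by (auto simp: first_return_def)
qed

lemma funpow_add_apply: "(f ^^ (m + n)) x = (f ^^ m) ((f ^^ n) x)"
  by (simp add: funpow_add)

lemma bij_betw_first_return:
  assumes bij: "bij_betw f X X" and "A \<subseteq> X"
    and forward: "\<And>x. x \<in> A \<Longrightarrow> \<exists>n>0. (f ^^ n) x \<in> A"
    and backward: "\<And>y. y \<in> A \<Longrightarrow> \<exists>n>0. \<exists>x\<in>A. (f ^^ n) x = y"
  shows "bij_betw (first_return f A) A A"
proof -
  have inj: "inj_on (f ^^ n) X" and closed: "x \<in> X \<Longrightarrow> (f ^^ n) x \<in> X" for n x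
    using bij_betw_funpow[OF bij, of n] by (auto simp: bij_betw_def)
  \<comment> \<open>Two points with the same return image have equal return times: cancelling
    \<open>r\<close> steps would make \<open>x\<close> a visit of the orbit of \<open>y\<close> to
    \<open>A\<close> before its first return.\<close>
  have later: False
    if "x \<in> A" "y \<in> A" "r < s" "(f ^^ r) x = (f ^^ s) y" 
      "\<And>j. 0 < j \<Longrightarrow> j < s \<Longrightarrow> (f ^^ j) y \<notin> A" "0 < r" for x y r s
  proof -
    have "(f ^^ r) x = (f ^^ r) ((f ^^ (s - r)) y)"
      using that(3,4) by (simp flip: funpow_add_apply)
    then have "x = (f ^^ (s - r)) y"
      using inj[of r] closed that(1,2) \<open>A \<subseteq> X\<close> by (meson inj_onD subsetD)
    then show False using that by auto
  qed
  have "x = y" if xy: "x \<in> A" "y \<in> A" "first_return f A x = first_return f A y" for x y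
  proof -
    obtain m where "0 < m" "(f ^^ m) x \<in> A" using forward xy by blast
    then obtain r where r: "0 < r" "first_return f A x = (f ^^ r) x"
      "\<And>j. 0 < j \<Longrightarrow> j < r \<Longrightarrow> (f ^^ j) x \<notin> A" by (metis first_returnE)
    obtain m where "0 < m" "(f ^^ m) y \<in> A" using forward xy by blast
    then obtain s where s: "0 < s" "first_return f A y = (f ^^ s) y"
      "\<And>j. 0 < j \<Longrightarrow> j < s \<Longrightarrow> (f ^^ j) y \<notin> A" by (metis first_returnE)
    have "r = s"
      using later[OF xy(1,2), of r s] later[OF xy(2,1), of s r] r s xy(3)
      by (metis linorder_neqE_nat)
    then show ?thesis
      using r s xy inj[of r] \<open>A \<subseteq> X\<close> by (metis inj_onD subsetD)
  qed
  moreover have "first_return f A x \<in> A" if "x \<in> A" for x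
    using forward[OF that] by (metis first_returnE)
  moreover have "\<exists>x\<in>A. first_return f A x = y" if yA: "y \<in> A" for y
  proof -
    \<comment> \<open>A point of \<open>A\<close> reaching \<open>y\<close> in the fewest steps has
      \<open>y\<close> as first return; an earlier return of it would reach \<open>y\<close> even
      sooner.\<close>
    let ?P = "\<lambda>n. 0 < n \<and> (\<exists>x\<in>A. (f ^^ n) x = y)"
    define n where "n = (LEAST n. ?P n)"
    have "?P n" unfolding n_def by (rule LeastI_ex) (rule backward[OF yA])
    then obtain x where x: "x \<in> A" "(f ^^ n) x = y" "0 < n" by blast
    obtain r where r: "0 < r" "r \<le> n" "(f ^^ r) x \<in> A" "first_return f A x = (f ^^ r) x"
      using first_returnE[of n f x A] x yA by metis
    have "r = n"
    proof (rule ccontr)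
      assume "r \<noteq> n"
      have "(f ^^ (n - r)) ((f ^^ r) x) = y"
        using r x by (simp flip: funpow_add_apply)
      moreover have "0 < n - r" using r \<open>r \<noteq> n\<close> by simp
      ultimately have "?P (n - r)" using r(3) by blast
      then have "n \<le> n - r" unfolding n_def by (rule Least_le)
      then show False using r by simp
    qed
    then show ?thesis using r x by auto
  qed
  ultimately show ?thesis
    unfolding bij_betw_def inj_on_def by blast
qed

text \<open>Cut the orbit at its visits to \<open>A\<close>. Each excursion takes at least one step,
  so \<open>m = n\<close> forces all of them to have length one. This last clause is what later
  makes the period drop strictly.\<close>

lemma first_return_count:
  assumes "x \<in> A" "0 < n" "(f ^^ n) x \<in> A"
  shows "\<exists>m. 0 < m \<and> m \<le> n \<and> (first_return f A ^^ m) x = (f ^^ n) x \<and>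
    (m = n \<longrightarrow> (\<forall>j\<le>n. (f ^^ j) x \<in> A))"
  using assms
proof (induction n arbitrary: x rule: less_induct)
  case (less n)
  obtain r where r: "0 < r" "r \<le> n" "(f ^^ r) x \<in> A" "first_return f A x = (f ^^ r) x"
    using first_returnE[of n f x A] less.prems by metis
  show ?case
  proof (cases "r = n")
    case True
    then show ?thesis using r less.prems
      by (intro exI[of _ 1]) (auto simp: le_Suc_eq)
  next
    case False
    have *: "(f ^^ (n - r)) ((f ^^ r) x) = (f ^^ n) x"
      using r by (simp flip: funpow_add_apply)
    obtain m where m: "0 < m" "m \<le> n - r"
      "(first_return f A ^^ m) ((f ^^ r) x) = (f ^^ n) x"
      "m = n - r \<longrightarrow> (\<forall>j\<le>n - r. (f ^^ j) ((f ^^ r) x) \<in> A)"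
      using less.IH[of "n - r" "(f ^^ r) x"] False r less.prems * by auto
    have "(f ^^ j) x \<in> A" if "Suc m = n" "j \<le> n" for j
    proof (cases j)
      case (Suc i)
      have "r = 1" "m = n - r" "i \<le> n - r" using m r that Suc by auto
      then show ?thesis using m Suc by (simp add: funpow_swap1)
    qed (use less.prems in simp)
    then show ?thesis using m r
      by (intro exI[of _ "Suc m"]) (auto simp del: funpow.simps simp: funpow_Suc_right)
  qed
qed

subsection \<open>Kept positions\<close>

lemma Omega_sign: "u \<in> Omega \<Longrightarrow> u x = 1 \<or> u x = -1"
  by (auto simp: Omega_iff)

lemma Omega_square: "u \<in> Omega \<Longrightarrow> u x * u x = 1"
  using Omega_sign[of u x] by auto

lemma Omega_square_left: "u \<in> Omega \<Longrightarrow> u x * (u x * z) = z"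
  using Omega_sign[of u x] by auto

lemma shift_in_Omega: "u \<in> Omega \<Longrightarrow> (\<lambda>n. u (n + k)) \<in> Omega"
  by (auto simp: Omega_iff)

text \<open>A sign -1 can only be the left half of a deleted pair and a sign 1 only the right half,
  so \<open>x - u x\<close> is the sole candidate for the partner of \<open>x\<close>.\<close>

lemma K_iff: "u \<in> Omega \<Longrightarrow> x \<in> K u \<longleftrightarrow> u (x - u x) = u x"
  using Omega_sign[of u x] Omega_sign[of u "x + 1"] Omega_sign[of u "x - 1"]
  by (auto simp: K_def shift_pow_eq S_def shift_in_Omega add.commute)

lemma removed_partner:
  assumes "u \<in> Omega" "x \<notin> K u"
  shows "u (x - u x) = - u x" "x - u x \<notin> K u"
  using assms Omega_sign[OF assms(1), of x] Omega_sign[OF assms(1), of "x - u x"]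
  by (auto simp: K_iff)

text \<open>With equal signs, one of the two positions would be the partner of the other, but
  partners carry opposite signs.\<close>

lemma removed_adjacent:
  assumes "u \<in> Omega" "x \<notin> K u" "x + a \<notin> K u" "a = 1 \<or> a = -1"
  shows "u (x + a) = - u x"
  using assms Omega_sign[OF assms(1), of x] Omega_sign[OF assms(1), of "x + a"]
  by (auto simp: K_iff)

text \<open>With sign \<open>a\<close> the removed position would have \<open>x\<close> as its
  partner, and then \<open>x\<close> would be removed too.\<close>

lemma removed_next_to_kept:
  assumes "u \<in> Omega" "x \<in> K u" "x + a \<notin> K u" "a = 1 \<or> a = -1"
  shows "u (x + a) = - a"
  using assms removed_partner[OF assms(1,3)] Omega_sign[OF assms(1), of "x + a"]
  by (auto)

subsection \<open>The walk\<close>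

lemma N_iff: "(a, b) \<in> N \<longleftrightarrow> (b = 0 \<and> (a = 1 \<or> a = -1)) \<or> (a = 0 \<and> (b = 1 \<or> b = -1))"
  by (auto simp: N_def)

lemma walk_in_N:
  assumes "u \<in> Omega" "u' \<in> Omega" "snd (snd p) \<in> N"
  shows "snd (snd ((walk u u' ^^ n) p)) \<in> N"
proof (induction n)
  case (Suc n)
  obtain x y a b where "(walk u u' ^^ n) p = (x, y, a, b)" by (metis prod.exhaust)
  then show ?case using Suc Omega_sign[OF assms(1), of x] Omega_sign[OF assms(2), of y]
    by (auto simp: walk_def N_iff)
qed (use assms in simp)

text \<open>Exchanging the axes lets every claim about horizontal states be transferred to vertical
  ones.\<close>

lemma walk_transpose: "walk u' u (transpose p) = transpose (walk u u' p)"
  by (auto simp: walk_def transpose_def Let_def mult.commute split: prod.splits)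

lemma walk_transpose_pow: "(walk u' u ^^ n) (transpose p) = transpose ((walk u u' ^^ n) p)"
  by (induction n) (auto simp: walk_transpose)

lemma transpose_transpose [simp]: "transpose (transpose p) = p"
  by (auto simp: transpose_def split: prod.splits)

lemma transpose_inject: "transpose p = transpose q \<longleftrightarrow> p = q"
  by (metis transpose_transpose)

lemma transpose_kept: "transpose p \<in> kept u' u \<longleftrightarrow> p \<in> kept u u'"
  by (auto simp: transpose_def kept_def N_iff split: prod.splits)

lemma reverse_reverse: "u \<in> Omega \<Longrightarrow> u' \<in> Omega \<Longrightarrow> reverse u u' (reverse u u' p) = p"
  using Omega_sign[of u "fst p"] Omega_sign[of u' "fst (snd p)"]
  by (auto simp: reverse_def Let_def split: prod.splits)

lemma reverse_kept:
  assumes "u \<in> Omega" "u' \<in> Omega" "p \<in> kept u u'"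
  shows "reverse u u' p \<in> kept u u'"
proof -
  obtain x y a b where p: "p = (x, y, a, b)" by (metis prod.exhaust)
  show ?thesis using assms Omega_sign[OF assms(1), of x] Omega_sign[OF assms(2), of y]
    by (auto simp: p reverse_def kept_def N_iff)
qed

text \<open>The sign at the new tile enters once through the reversal and once through the step
  back, and cancels.\<close>

lemma walk_reverse_walk:
  assumes "u \<in> Omega" "u' \<in> Omega"
  shows "walk u u' (reverse u u' (walk u u' p)) = reverse u u' p"
proof -
  obtain x y a b where p: "p = (x, y, a, b)" by (metis prod.exhaust)
  let ?s = "u x * u' y"
  have "u (x + ?s * b) * u' (y + ?s * a) = 1 \<or> u (x + ?s * b) * u' (y + ?s * a) = -1"
    using Omega_sign[OF assms(1), of "x + ?s * b"] Omega_sign[OF assms(2), of "y + ?s * a"] by auto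
  then show ?thesis by (auto simp: p walk_def reverse_def Let_def)
qed

lemma walk_reverse_walk_pow:
  assumes "u \<in> Omega" "u' \<in> Omega"
  shows "(walk u u' ^^ n) (reverse u u' ((walk u u' ^^ n) p)) = reverse u u' p"
proof (induction n arbitrary: p)
  case (Suc n)
  have "(walk u u' ^^ Suc n) (reverse u u' ((walk u u' ^^ Suc n) p)) = 
    (walk u u' ^^ n) (walk u u' (reverse u u' (walk u u' ((walk u u' ^^ n) p))))"
    by (simp add: funpow_swap1)
  then show ?case using Suc by (simp add: walk_reverse_walk[OF assms])
qed simp

lemma walk_pow_inject:
  assumes "u \<in> Omega" "u' \<in> Omega" "(walk u u' ^^ n) p = (walk u u' ^^ n) q"
  shows "p = q"
  using assms walk_reverse_walk_pow[of u u' n] reverse_reverse[of u u'] by metis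

text \<open>Both turns take place in column \<open>x\<close>, so \<open>u x\<close> cancels: whether
  the horizontal direction flips depends only on the signs of the two rows.\<close>

lemma walk_two_steps:
  assumes "u \<in> Omega" "u' \<in> Omega" "y1 = y + a * u x * u' y" "a1 = a * u' y * u' y1"
  shows "walk u u' (walk u u' (x, y, a, 0)) = (x + a1, y1, a1, 0)"
  using assms Omega_sign[OF assms(1), of x]
  by (auto simp: walk_def Let_def algebra_simps)

lemma funpow_4: "(f ^^ 4) x = f (f (f (f x)))"
  by (simp add: eval_nat_numeral)

lemma walk_four_steps:
  assumes "u \<in> Omega" "u' \<in> Omega" "y1 = y + a * u x * u' y" "a1 = a * u' y * u' y1"
    "y2 = y1 + a1 * u (x + a1) * u' y1" "a2 = a1 * u' y1 * u' y2"
  shows "(walk u u' ^^ 4) (x, y, a, 0) = (x + a1 + a2, y2, a2, 0)"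
  unfolding funpow_4 using assms by (subst walk_two_steps; simp)+

subsection \<open>Traversing removed columns\<close>

text \<open>Since \<open>y\<close> is kept, row \<open>y - u' y\<close> has the same sign, so the
  walk sidesteps into it without flipping \<open>a\<close>. The partner column has the opposite sign
  and sends it back to row \<open>y\<close>. Only columns \<open>x\<close> and \<open>x + a\<close>
  are met before the fourth step.\<close>

lemma pass_removed_pair:
  assumes "u \<in> Omega" "u' \<in> Omega" "y \<in> K u'" "a = 1 \<or> a = -1" "x \<notin> K u" "u x = - a"
  shows "(walk u u' ^^ 4) (x, y, a, 0) = (x + 2 * a, y, a, 0)"
    and "j < 4 \<Longrightarrow> (walk u u' ^^ j) (x, y, a, 0) \<notin> kept u u'"
proof -
  have x1: "u (x + a) = a" "x + a \<notin> K u"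
    using removed_partner[OF assms(1,5)] assms(6) by auto
  have y1: "u' (y - u' y) = u' y" using assms by (simp add: K_iff)
  have aa: "a * a = 1" "a * (a * z) = z" for z using assms(4) by auto
  have two: "walk u u' (walk u u' (x, y, a, 0)) = (x + a, y - u' y, a, 0)"
    by (rule walk_two_steps) (use assms y1 aa in \<open>auto simp: Omega_square mult.assoc\<close>)
  have four: "walk u u' (walk u u' (x + a, y - u' y, a, 0)) = (x + a + a, y, a, 0)"
    by (rule walk_two_steps) (use assms x1 y1 aa in \<open>auto simp: Omega_square mult.assoc\<close>)
  show "(walk u u' ^^ 4) (x, y, a, 0) = (x + 2 * a, y, a, 0)"
    unfolding funpow_4 two four by simp
  have "fst (walk u u' (x, y, a, 0)) = x" "fst (walk u u' (x + a, y - u' y, a, 0)) = x + a"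
    by (auto simp: walk_def Let_def)
  then have one: "walk u u' (x, y, a, 0) \<notin> kept u u'"
    and three: "walk u u' (x + a, y - u' y, a, 0) \<notin> kept u u'"
    using assms x1 by (auto simp: kept_def)
  assume "j < 4"
  then consider "j = 0" | "j = 1" | "j = 2" | "j = 3" by linarith
  then show "(walk u u' ^^ j) (x, y, a, 0) \<notin> kept u u'"
    using one three two assms x1 by cases (auto simp: eval_nat_numeral kept_def)
qed

text \<open>Removed columns ahead are crossed pair by pair. The condition on \<open>x\<close> says
  that a pair is entered at its near side; each crossing restores it, and the distance bound
  \<open>d\<close> falls by two.\<close>

lemma corridor:
  assumes "u \<in> Omega" "u' \<in> Omega" "y \<in> K u'" "a = 1 \<or> a = -1"
    and "x + a * int d \<in> K u" "x \<in> K u \<or> u x = - a"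
  shows "\<exists>n e. x + a * int e \<in> K u \<and> (\<forall>i<e. x + a * int i \<notin> K u) \<and>
    (walk u u' ^^ n) (x, y, a, 0) = (x + a * int e, y, a, 0) \<and>
    (\<forall>j<n. (walk u u' ^^ j) (x, y, a, 0) \<notin> kept u u')"
  using assms(5,6)
proof (induction d arbitrary: x rule: less_induct)
  case (less d)
  show ?case
  proof (cases "x \<in> K u")
    case True
    then show ?thesis by (intro exI[of _ 0]) auto
  next
    case False
    then have ux: "u x = - a" using less.prems by auto
    have x1: "u (x + a) = a" "x + a \<notin> K u"
      using removed_partner[OF assms(1) False] ux by auto
    \<comment> \<open>Both \<open>x\<close> and its partner \<open>x + a\<close> are removed, so the
      target is at least two columns away.\<close>
    have "d \<noteq> 0" using less.prems False by (intro notI) auto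
    moreover have "d \<noteq> 1" using less.prems x1 by (intro notI) auto
    ultimately obtain c where d: "d = Suc (Suc c)" by (metis One_nat_def not0_implies_Suc)
    have "(x + 2 * a) + a * int c \<in> K u"
      using less.prems d by (simp add: algebra_simps)
    moreover have "x + 2 * a \<in> K u \<or> u (x + 2 * a) = - a"
      using removed_adjacent[OF assms(1) x1(2), of a] assms(4) x1 by (auto simp: algebra_simps)
    ultimately obtain n e where ne: "(x + 2 * a) + a * int e \<in> K u"
      "\<And>i. i < e \<Longrightarrow> (x + 2 * a) + a * int i \<notin> K u"
      "(walk u u' ^^ n) (x + 2 * a, y, a, 0) = (x + 2 * a + a * int e, y, a, 0)"
      "\<And>j. j < n \<Longrightarrow> (walk u u' ^^ j) (x + 2 * a, y, a, 0) \<notin> kept u u'"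
      using less.IH[of c "x + 2 * a"] d by auto
    note pass = pass_removed_pair[OF assms(1-4) False ux]
    have "x + a * int i \<notin> K u" if "i < e + 2" for i
    proof -
      consider "i = 0" | "i = 1" | c where "i = Suc (Suc c)" "c < e"
        using \<open>i < e + 2\<close> by (metis One_nat_def add_2_eq_Suc' not0_implies_Suc not_less_eq)
      then show ?thesis
        using False x1 ne(2) by cases (auto simp: algebra_simps)
    qed
    moreover have "(walk u u' ^^ j) (x, y, a, 0) \<notin> kept u u'" if "j < n + 4" for j
    proof (cases "j < 4")
      case False
      then have "(walk u u' ^^ j) (x, y, a, 0) = (walk u u' ^^ (j - 4)) (x + 2 * a, y, a, 0)"
        by (simp flip: pass(1) funpow_add_apply)
      then show ?thesis using ne(4)[of "j - 4"] that False by auto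
    qed (rule pass(2))
    moreover have "(walk u u' ^^ (n + 4)) (x, y, a, 0) = (x + a * int (e + 2), y, a, 0)"
      using ne(3) by (simp add: funpow_add_apply pass(1) algebra_simps del: funpow.simps)
    moreover have "x + a * int (e + 2) \<in> K u" using ne(1) by (simp add: algebra_simps)
    ultimately show ?thesis by blast
  qed
qed

lemma unbounded_direction:
  assumes "unbounded_collapsible u" "a = 1 \<or> a = -1"
  shows "\<exists>d. x + a * int d \<in> K u"
proof -
  have "\<exists>z\<in>K u. 0 \<le> a * (z - x)"
    using assms unfolding unbounded_collapsible_def bdd_above_def bdd_below_def
    by (metis diff_ge_0_iff_ge linorder_le_cases minus_diff_eq mult_1 mult_minus1)
  then obtain z where "z \<in> K u" "0 \<le> a * (z - x)" by blast
  moreover from this have "x + a * int (nat (a * (z - x))) = z" using assms(2) by auto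
  ultimately show ?thesis by metis
qed

text \<open>The first step turns a vertical arrival into horizontal motion along the kept row
  \<open>y\<close>; the corridor then leads to the nearest kept column in direction
  \<open>a\<close>.\<close>

lemma first_return_step:
  assumes "u \<in> Omega" "u' \<in> Omega" "unbounded_collapsible u" "x \<in> K u" "y \<in> K u'"
    and b: "b = 1 \<or> b = -1" and a: "a = u x * u' y * b"
  shows "\<exists>e. x + a * int (Suc e) \<in> K u \<and> (\<forall>i<e. x + a * int (Suc i) \<notin> K u) \<and>
    first_return (walk u u') (kept u u') (x, y, 0, b) = (x + a * int (Suc e), y, a, 0)"
proof -
  have a1: "a = 1 \<or> a = -1"
    using a b Omega_sign[OF assms(1), of x] Omega_sign[OF assms(2), of y] by auto
  obtain d where d: "(x + a) + a * int d \<in> K u" using unbounded_direction[OF assms(3) a1] by blast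
  have entry: "x + a \<in> K u \<or> u (x + a) = - a"
    using removed_next_to_kept[OF assms(1,4) _ a1] by blast
  obtain n e where ne: "(x + a) + a * int e \<in> K u"
    "\<And>i. i < e \<Longrightarrow> (x + a) + a * int i \<notin> K u"
    "(walk u u' ^^ n) (x + a, y, a, 0) = (x + a + a * int e, y, a, 0)"
    "\<And>j. j < n \<Longrightarrow> (walk u u' ^^ j) (x + a, y, a, 0) \<notin> kept u u'"
    using corridor[OF assms(1,2,5) a1 d entry] by blast
  have step: "walk u u' (x, y, 0, b) = (x + a, y, a, 0)" by (simp add: walk_def Let_def a)
  have "first_return (walk u u') (kept u u') (x, y, 0, b) = (walk u u' ^^ Suc n) (x, y, 0, b)"
  proof (rule first_returnI)
    show "(walk u u' ^^ Suc n) (x, y, 0, b) \<in> kept u u'"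
      using ne a1 assms by (auto simp: funpow_Suc_right step kept_def N_iff simp del: funpow.simps)
    show "(walk u u' ^^ j) (x, y, 0, b) \<notin> kept u u'" if "0 < j" "j < Suc n" for j
      using that ne(4)[of "j - 1"]
      by (cases j) (auto simp: funpow_Suc_right step simp del: funpow.simps)
  qed simp
  then show ?thesis
    using ne by (intro exI[of _ e]) (auto simp: funpow_Suc_right step algebra_simps simp del: funpow.simps)
qed

subsection \<open>Reaching the kept set\<close>

text \<open>The line of travel is kept, although the tile itself may not be; this is the situation
  inside a corridor.\<close>

definition aligned :: "seq \<Rightarrow> seq \<Rightarrow> int \<times> int \<times> int \<times> int \<Rightarrow> bool" where
  "aligned u u' = (\<lambda>(x, y, a, b). b = 0 \<and> y \<in> K u' \<or> a = 0 \<and> x \<in> K u)"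

lemma aligned_transpose: "aligned u' u (transpose p) \<longleftrightarrow> aligned u u' p"
  by (auto simp: aligned_def transpose_def split: prod.splits)

text \<open>The corridor applies unless \<open>x\<close> is the far half of a removed pair. Then the
  walk first moves to row \<open>y + u' y\<close>, and the sign found there decides between escape
  and a loop.\<close>

lemma aligned_row_reaches_kept:
  assumes "u \<in> Omega" "u' \<in> Omega" "unbounded_collapsible u" "y \<in> K u'" "a = 1 \<or> a = -1"
  shows "(walk u u' ^^ 4) (x, y, a, 0) = (x, y, a, 0) \<or>
    (\<exists>n. (walk u u' ^^ n) (x, y, a, 0) \<in> kept u u')"
proof -
  have entering: "\<exists>n. (walk u u' ^^ n) (x, y, a, 0) \<in> kept u u'"
    if y: "y \<in> K u'" and xa: "x \<in> K u \<or> u x = - a" for x y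
  proof -
    obtain d where "x + a * int d \<in> K u" using unbounded_direction assms(3,5) by blast
    from corridor[OF assms(1,2) y assms(5) this xa] obtain n e where
      "x + a * int e \<in> K u" "(walk u u' ^^ n) (x, y, a, 0) = (x + a * int e, y, a, 0)" by blast
    then show ?thesis using y assms(5) by (intro exI[of _ n]) (auto simp: kept_def N_iff)
  qed
  show ?thesis
  proof (cases "x \<in> K u \<or> u x = - a")
    case False
    then have x: "x \<notin> K u" "u x = a" using Omega_sign[OF assms(1), of x] assms(5) by auto
    then have x1: "u (x - a) = - a" using removed_partner[OF assms(1)] by metis
    have aa: "a * a = 1" "a * (a * z) = z" for z using assms(5) by auto
    let ?y1 = "y + u' y"
    show ?thesis
    \<comment> \<open>Equal signs make the new row kept, as its only possible partner is
      \<open>y\<close>; the walk leaves the pair along it. Opposite signs turn the walk back into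
      the partner column and close it.\<close>
    proof (cases "u' ?y1 = u' y")
      case True
      then have y1: "?y1 \<in> K u'" using assms(2) by (simp add: K_iff)
      have two: "walk u u' (walk u u' (x, y, a, 0)) = (x + a, ?y1, a, 0)"
        by (rule walk_two_steps) (use assms x True aa in \<open>auto simp: Omega_square mult.assoc\<close>)
      have "x + a \<in> K u \<or> u (x + a) = - a"
        using removed_adjacent[OF assms(1) x(1), of a] assms(5) x(2) by auto
      then obtain n where "(walk u u' ^^ n) (walk u u' (walk u u' (x, y, a, 0))) \<in> kept u u'"
        unfolding two using entering y1 by blast
      then have "(walk u u' ^^ (n + 2)) (x, y, a, 0) \<in> kept u u'"
        by (simp add: eval_nat_numeral funpow_swap1)
      then show ?thesis by blast
    next
      case False
      then have y1: "u' ?y1 = - u' y"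
        using Omega_sign[OF assms(2), of y] Omega_sign[OF assms(2), of ?y1] by auto
      have "(walk u u' ^^ 4) (x, y, a, 0) = (x + - a + a, y, a, 0)"
        by (rule walk_four_steps[where ?y1.0 = ?y1])
          (use assms x x1 y1 aa in \<open>auto simp: Omega_square mult.assoc\<close>)
      then show ?thesis by simp
    qed
  qed (use entering assms in blast)
qed

lemma aligned_reaches_kept:
  assumes "u \<in> Omega" "u' \<in> Omega" "unbounded_collapsible u" "unbounded_collapsible u'"
    and "aligned u u' p" "snd (snd p) \<in> N"
  shows "(walk u u' ^^ 4) p = p \<or> (\<exists>n. (walk u u' ^^ n) p \<in> kept u u')"
proof -
  obtain x y a b where p: "p = (x, y, a, b)" by (metis prod.exhaust)
  consider "b = 0" "y \<in> K u'" "a = 1 \<or> a = -1" | "a = 0" "x \<in> K u" "b = 1 \<or> b = -1"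
    using assms(5,6) p by (auto simp: aligned_def N_iff)
  then show ?thesis
  proof cases
    case 1
    then show ?thesis using aligned_row_reaches_kept assms p by blast
  next
    case 2
    then have "transpose p = (y, x, b, 0)" by (simp add: p transpose_def)
    then have "(walk u' u ^^ 4) (transpose p) = transpose p \<or>
        (\<exists>n. (walk u' u ^^ n) (transpose p) \<in> kept u' u)"
      using aligned_row_reaches_kept[OF assms(2,1,4) 2(2,3)] by simp
    then show ?thesis by (simp add: walk_transpose_pow transpose_inject transpose_kept)
  qed
qed

text \<open>Adjacent removed positions carry opposite signs, so a walk which is never aligned keeps
  turning to the same side.\<close>

lemma row_eventually_aligned:
  assumes "u \<in> Omega" "u' \<in> Omega" "a = 1 \<or> a = -1"
  shows "(walk u u' ^^ 4) (x, y, a, 0) = (x, y, a, 0) \<or>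
    (\<exists>n. aligned u u' ((walk u u' ^^ n) (x, y, a, 0)))"
proof (rule disjCI)
  assume never: "\<nexists>n. aligned u u' ((walk u u' ^^ n) (x, y, a, 0))"
  have n0: "\<not> aligned u u' (x, y, a, 0)" using never by (metis funpow_0)
  have n1: "\<not> aligned u u' (walk u u' (x, y, a, 0))"
    using never by (metis funpow_0 funpow.simps(2) comp_apply)
  have n2: "\<not> aligned u u' (walk u u' (walk u u' (x, y, a, 0)))"
    using never by (metis funpow_0 funpow.simps(2) comp_apply)
  have n3: "\<not> aligned u u' (walk u u' (walk u u' (walk u u' (x, y, a, 0))))"
    using never by (metis funpow_0 funpow.simps(2) comp_apply)
  let ?b = "a * u x * u' y"
  have b: "?b = 1 \<or> ?b = -1"
    using assms(3) Omega_sign[OF assms(1), of x] Omega_sign[OF assms(2), of y] by auto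
  have aa: "a * a = 1" "a * (a * z) = z" for z using assms(3) by auto
  \<comment> \<open>The initial state is horizontal and tests row \<open>y\<close>; the next one is
    vertical, still in column \<open>x\<close>, and tests that column.\<close>
  have yx: "y \<notin> K u'" "x \<notin> K u"
    using n0 n1 by (auto simp: aligned_def walk_def Let_def)
  have "walk u u' (walk u u' (x, y, a, 0)) = 
      (x + a * u' y * u' (y + ?b), y + ?b, a * u' y * u' (y + ?b), 0)"
    by (rule walk_two_steps) (use assms in auto)
  then have "y + ?b \<notin> K u'" using n2 by (auto simp: aligned_def)
  then have y1: "u' (y + ?b) = - u' y"
    using removed_adjacent[OF assms(2) yx(1)] b by blast
  have two: "walk u u' (walk u u' (x, y, a, 0)) = (x - a, y + ?b, - a, 0)"
    using walk_two_steps[OF assms(1,2) refl refl, of x y a] y1 assms(2)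
    by (simp add: Omega_square Omega_square_left mult.assoc)
  have "x + - a \<notin> K u"
    using n3 unfolding two by (auto simp: aligned_def walk_def Let_def)
  then have "u (x + - a) = - u x"
    using removed_adjacent[OF assms(1) yx(2)] assms(3) by fastforce
  then have "(walk u u' ^^ 4) (x, y, a, 0) = (x + - a + a, y, a, 0)"
    by (intro walk_four_steps[where ?y1.0 = "y + ?b"])
      (use assms y1 aa in \<open>auto simp: Omega_square Omega_square_left mult.assoc\<close>)
  then show "(walk u u' ^^ 4) (x, y, a, 0) = (x, y, a, 0)" by simp
qed

lemma reaches_kept:
  assumes "u \<in> Omega" "u' \<in> Omega" "unbounded_collapsible u" "unbounded_collapsible u'"
    and "snd (snd p) \<in> N"
  shows "(walk u u' ^^ 4) p = p \<or> (\<exists>n>0. (walk u u' ^^ n) p \<in> kept u u')"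
proof -
  \<comment> \<open>Starting one step later guarantees a positive number of steps.\<close>
  let ?q = "walk u u' p"
  have q: "snd (snd ?q) \<in> N" using walk_in_N[OF assms(1,2,5), of 1] by simp
  obtain x y a b where xy: "?q = (x, y, a, b)" by (metis prod.exhaust)
  have "(walk u u' ^^ 4) ?q = ?q \<or> (\<exists>n. aligned u u' ((walk u u' ^^ n) ?q))"
  proof (cases "b = 0")
    case True
    then show ?thesis using row_eventually_aligned assms(1,2) q xy by (auto simp: N_iff)
  next
    case False
    then have "transpose ?q = (y, x, b, 0)" "b = 1 \<or> b = -1"
      using q xy by (auto simp: N_iff transpose_def)
    then have "(walk u' u ^^ 4) (transpose ?q) = transpose ?q \<or>
        (\<exists>n. aligned u' u ((walk u' u ^^ n) (transpose ?q)))"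
      using row_eventually_aligned[OF assms(2,1)] by metis
    then show ?thesis by (simp add: walk_transpose_pow transpose_inject aligned_transpose)
  qed
  then have "(walk u u' ^^ 4) ?q = ?q \<or> (\<exists>n. (walk u u' ^^ n) ?q \<in> kept u u')"
  proof
    assume "\<exists>n. aligned u u' ((walk u u' ^^ n) ?q)"
    then obtain n where "aligned u u' ((walk u u' ^^ n) ?q)" by blast
    from aligned_reaches_kept[OF assms(1-4) this walk_in_N[OF assms(1,2) q]]
    show ?thesis
    proof
      assume "(walk u u' ^^ 4) ((walk u u' ^^ n) ?q) = (walk u u' ^^ n) ?q"
      \<comment> \<open>A loop met later is already present at the start, because iterates of the
        walk are injective.\<close>
      then have "(walk u u' ^^ n) ((walk u u' ^^ 4) ?q) = (walk u u' ^^ n) ?q"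
        by (metis funpow_add_apply add.commute)
      then show ?thesis using walk_pow_inject[OF assms(1,2)] by blast
    qed (metis funpow_add_apply)
  qed blast
  then show ?thesis
  proof
    assume "(walk u u' ^^ 4) ?q = ?q"
    then have "(walk u u' ^^ 1) ((walk u u' ^^ 4) p) = (walk u u' ^^ 1) p"
      by (simp add: funpow_swap1)
    then show ?thesis using walk_pow_inject[OF assms(1,2)] by blast
  next
    assume "\<exists>n. (walk u u' ^^ n) ?q \<in> kept u u'"
    then obtain n where "(walk u u' ^^ Suc n) p \<in> kept u u'" by (auto simp: funpow_swap1)
    then show ?thesis by blast
  qed
qed

text \<open>Apply the forward statement to the reversed state and reverse the tile reached;
  \<open>reverse\<close> preserves \<open>kept\<close> and retraces the path.\<close>

lemma reached_from_kept:
  assumes "u \<in> Omega" "u' \<in> Omega" "unbounded_collapsible u" "unbounded_collapsible u'"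
    and "snd (snd p) \<in> N"
  shows "(walk u u' ^^ 4) p = p \<or> (\<exists>n>0. \<exists>q\<in>kept u u'. (walk u u' ^^ n) q = p)"
proof -
  let ?J = "reverse u u'"
  have "snd (snd (?J p)) \<in> N"
    using assms(5) Omega_sign[OF assms(1), of "fst p"] Omega_sign[OF assms(2), of "fst (snd p)"]
    by (auto simp: reverse_def N_iff Let_def split: prod.splits)
  then consider "(walk u u' ^^ 4) (?J p) = ?J p" |
    n where "0 < n" "(walk u u' ^^ n) (?J p) \<in> kept u u'"
    using reaches_kept[OF assms(1-4)] by blast
  then show ?thesis
  proof cases
    case 1
    then show ?thesis
      using walk_reverse_walk_pow[OF assms(1,2), of 4 "?J p"] reverse_reverse[OF assms(1,2), of p]
      by simp
  next
    case 2
    let ?q = "?J ((walk u u' ^^ n) (?J p))"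
    have "?q \<in> kept u u'" using reverse_kept assms 2 by blast
    moreover have "(walk u u' ^^ n) ?q = p"
      using walk_reverse_walk_pow[OF assms(1,2), of n "?J p"] reverse_reverse[OF assms(1,2), of p]
      by simp
    ultimately show ?thesis using 2 by blast
  qed
qed

subsection \<open>Closed walks\<close>

text \<open>Along an orbit of kept tiles the horizontal direction is eventually constant, so the
  walk drifts linearly in \<open>x\<close> and cannot return.\<close>

lemma kept_row_orbit_not_closed:
  assumes "u \<in> Omega" "u' \<in> Omega" "a = 1 \<or> a = -1" "0 < n"
    and kept: "\<And>j. (walk u u' ^^ j) (x, y, a, 0) \<in> kept u u'"
  shows "(walk u u' ^^ n) (x, y, a, 0) \<noteq> (x, y, a, 0)"
proof
  assume closed: "(walk u u' ^^ n) (x, y, a, 0) = (x, y, a, 0)"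
  \<comment> \<open>Every second state is horizontal, so sampling there leaves a single direction
    sign \<open>A\<close>.\<close>
  define q where "q j = (walk u u' ^^ (2 * j)) (x, y, a, 0)" for j
  define X Y A where "X j = fst (q j)" and "Y j = fst (snd (q j))" and "A j = fst (snd (snd (q j)))"
    for j
  have qSuc: "q (Suc j) = walk u u' (walk u u' (q j))" for j by (simp add: q_def)
  have "snd (snd (snd (q j))) = 0" for j
  proof (induction j)
    case (Suc j)
    then have "q j = (X j, Y j, A j, 0)" by (simp add: X_def Y_def A_def prod_eq_iff)
    then show ?case by (simp add: qSuc walk_two_steps[OF assms(1,2) refl refl])
  qed (simp add: q_def)
  then have q: "q j = (X j, Y j, A j, 0)" for j by (simp add: X_def Y_def A_def prod_eq_iff)
  have in_kept: "q j \<in> kept u u'" for j using kept by (simp add: q_def)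
  then have KX: "u (X j - u (X j)) = u (X j)" and KY: "u' (Y j - u' (Y j)) = u' (Y j)"
    and A: "A j = 1 \<or> A j = -1" for j
    using assms(1,2) by (auto simp: kept_def q K_iff N_iff)
  have next_q: "Y (Suc j) = Y j + A j * u (X j) * u' (Y j)"
    "A (Suc j) = A j * u' (Y j) * u' (Y (Suc j))" "X (Suc j) = X j + A (Suc j)" for j
    using qSuc[of j] walk_two_steps[OF assms(1,2) refl refl, of "X j" "Y j" "A j"]
    by (auto simp: q)
  \<comment> \<open>Here the walk moves to row \<open>Y j - u' (Y j)\<close> and then to column
    \<open>X j - u (X j)\<close>; keptness gives both the same sign as before, so the hypothesis
    reproduces itself.\<close>
  have trapped: "A (Suc j) = A j \<and> u (X (Suc j)) = - A (Suc j)" if "u (X j) = - A j" for j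
  proof -
    have "A j * u (X j) = -1" using that A[of j] by auto
    then have "Y (Suc j) = Y j - u' (Y j)" by (simp add: next_q(1))
    then have "A (Suc j) = A j" using KY[of j] assms(2) by (simp add: next_q(2) Omega_square mult.assoc)
    moreover from this have "X (Suc j) = X j - u (X j)" using that by (simp add: next_q(3))
    ultimately show ?thesis using KX[of j] that by simp
  qed
  \<comment> \<open>After one reversal the walk is trapped; before that it never reverses.\<close>
  have reversal: "u (X (Suc j)) = - A (Suc j)" if "A (Suc j) \<noteq> A j" for j
  proof -
    have "A (Suc j) = - A j" using that A[of j] A[of "Suc j"] by auto
    moreover have "u (X j) = A j"
      using that trapped[of j] A[of j] Omega_sign[OF assms(1), of "X j"] by auto
    ultimately show ?thesis using KX[of j] by (simp add: next_q(3))
  qed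
  obtain i where i: "\<And>j. A (i + Suc j) = A (i + j)"
  proof (cases "\<exists>i. u (X i) = - A i")
    case True
    then obtain i where "u (X i) = - A i" by blast
    then have "u (X (i + j)) = - A (i + j)" for j
      by (induction j) (use trapped in auto)
    then show thesis using trapped that[of i] by auto
  next
    case False
    then show thesis using reversal that[of 0] by auto
  qed
  have Ai: "A (i + j) = A i" for j by (induction j) (use i in auto)
  have "X (i + j) = X i + int j * A i" for j
  proof (induction j)
    case (Suc j)
    then show ?case using next_q(3)[of "i + j"] Ai[of "Suc j"] by (simp add: distrib_right)
  qed simp
  \<comment> \<open>The index counts double steps, so an increase by \<open>n\<close> covers two
    full periods.\<close>
  moreover have "q (i + n) = q i"
  proof -
    have "(walk u u' ^^ (n + n)) (x, y, a, 0) = (x, y, a, 0)"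
      by (simp add: funpow_add_apply closed)
    then show ?thesis
      by (simp add: q_def distrib_left funpow_add_apply mult_2)
  qed
  then have "X (i + n) = X i" by (simp add: X_def)
  ultimately show False using A[of i] \<open>0 < n\<close> by auto
qed

lemma kept_orbit_not_closed:
  assumes "u \<in> Omega" "u' \<in> Omega" "0 < n" and kept: "\<And>j. (walk u u' ^^ j) p \<in> kept u u'"
  shows "(walk u u' ^^ n) p \<noteq> p"
proof -
  obtain x y a b where p: "p = (x, y, a, b)" by (metis prod.exhaust)
  have "p \<in> kept u u'" using kept[of 0] by simp
  then consider "b = 0" "a = 1 \<or> a = -1" | "a = 0" "b = 1 \<or> b = -1"
    using p by (auto simp: kept_def N_iff)
  then show ?thesis
  proof cases
    case 1
    then show ?thesis using kept_row_orbit_not_closed assms p by metis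
  next
    case 2
    then have t: "transpose p = (y, x, b, 0)" by (simp add: p transpose_def)
    have "(walk u' u ^^ j) (transpose p) \<in> kept u' u" for j
      using kept by (simp add: walk_transpose_pow transpose_kept)
    then have "(walk u' u ^^ n) (transpose p) \<noteq> transpose p"
      unfolding t using kept_row_orbit_not_closed[OF assms(2,1) 2(2) assms(3)] by blast
    then show ?thesis by (simp add: walk_transpose_pow transpose_inject)
  qed
qed

section \<open>Short loops\<close>

text \<open>Closing up needs a flip, hence opposite signs in rows \<open>y\<close> and
  \<open>y1\<close>. Keptness of \<open>y\<close> then forces \<open>a = u x\<close>, and keptness
  of \<open>x\<close> makes the second vertical move repeat the first, ending two rows away.\<close>

lemma kept_row_not_four_periodic:
  assumes "u \<in> Omega" "u' \<in> Omega" "x \<in> K u" "y \<in> K u'" "a = 1 \<or> a = -1"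
  shows "(walk u u' ^^ 4) (x, y, a, 0) \<noteq> (x, y, a, 0)"
proof
  assume closed: "(walk u u' ^^ 4) (x, y, a, 0) = (x, y, a, 0)"
  define y1 where "y1 = y + a * u x * u' y"
  define a1 where "a1 = a * u' y * u' y1"
  define y2 where "y2 = y1 + a1 * u (x + a1) * u' y1"
  have eq: "a1 + a = 0" "y2 = y"
    using closed walk_four_steps[OF assms(1,2) y1_def a1_def y2_def refl] by auto
  have "a1 = - a" using eq by simp
  then have y1: "u' y1 = - u' y"
    using a1_def assms(5) Omega_sign[OF assms(2), of y] Omega_sign[OF assms(2), of y1] by auto
  have "a = u x"
  proof (rule ccontr)
    assume "a \<noteq> u x"
    then have "a * u x = -1" using assms(5) Omega_sign[OF assms(1), of x] by auto
    then have "y1 = y - u' y" by (simp add: y1_def)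
    then show False using y1 assms(2,4) Omega_sign[OF assms(2), of y] by (auto simp: K_iff)
  qed
  then have "u (x + a1) = u x" using \<open>a1 = - a\<close> assms(1,3) by (simp add: K_iff)
  then show False
    using eq(2) \<open>a = u x\<close> \<open>a1 = - a\<close> y1 Omega_sign[OF assms(1), of x] Omega_sign[OF assms(2), of y]
    by (auto simp: y2_def y1_def)
qed

lemma kept_not_four_periodic:
  assumes "u \<in> Omega" "u' \<in> Omega" "p \<in> kept u u'"
  shows "(walk u u' ^^ 4) p \<noteq> p"
proof -
  obtain x y a b where p: "p = (x, y, a, b)" by (metis prod.exhaust)
  then have xy: "x \<in> K u" "y \<in> K u'" using assms by (auto simp: kept_def)
  consider "b = 0" "a = 1 \<or> a = -1" | "a = 0" "b = 1 \<or> b = -1"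
    using assms p by (auto simp: kept_def N_iff)
  then show ?thesis
  proof cases
    case 1
    then show ?thesis using kept_row_not_four_periodic assms p xy by metis
  next
    case 2
    then have t: "transpose p = (y, x, b, 0)" by (simp add: p transpose_def)
    have "(walk u' u ^^ 4) (transpose p) \<noteq> transpose p"
      unfolding t using kept_row_not_four_periodic[OF assms(2,1) xy(2,1) 2(2)] by blast
    then show ?thesis by (simp add: walk_transpose_pow transpose_inject)
  qed
qed

text \<open>An odd number of steps exchanges horizontal and vertical directions, and two steps
  change both coordinates by one.\<close>

lemma walk_not_closed_below_four:
  assumes "u \<in> Omega" "u' \<in> Omega" "snd (snd p) \<in> N" "0 < m" "m < 4"
  shows "(walk u u' ^^ m) p \<noteq> p"
proof -
  obtain x y a b where p: "p = (x, y, a, b)" by (metis prod.exhaust)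
  have nz: "u z \<noteq> 0" "u' z \<noteq> 0" for z
    using Omega_sign[OF assms(1), of z] Omega_sign[OF assms(2), of z] by auto
  consider "m = 1" | "m = 2" | "m = 3" using assms(4,5) by linarith
  then show ?thesis
    using assms(3) nz by cases (auto simp: p walk_def Let_def N_iff eval_nat_numeral)
qed

subsection \<open>Stable periodicity as closedness of the walk\<close>

text \<open>The configuration as seen from the moving point. For periodic sequences different
  positions can give the same configuration.\<close>

definition place :: "seq \<Rightarrow> seq \<Rightarrow> int \<times> int \<times> int \<times> int \<Rightarrow> point" where
  "place u u' = (\<lambda>(x, y, v). (\<lambda>n. u (n + x), \<lambda>n. u' (n + y), v))"

lemma place_origin: "place u u' (0, 0, v) = (u, u', v)"
  by (simp add: place_def)

lemma Phi_place:
  assumes "u \<in> Omega" "u' \<in> Omega"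
  shows "Phi (place u u' p) = place u u' (walk u u' p)"
proof -
  obtain x y a b where p: "p = (x, y, a, b)" by (metis prod.exhaust)
  show ?thesis using assms
    by (simp add: p place_def walk_def Let_def shift_pow_eq shift_in_Omega algebra_simps)
qed

lemma Phi_pow_place:
  assumes "u \<in> Omega" "u' \<in> Omega"
  shows "(Phi ^^ n) (place u u' p) = place u u' ((walk u u' ^^ n) p)"
  by (induction n) (auto simp: Phi_place[OF assms] simp del: Phi.simps)

text \<open>Before step \<open>n\<close> each coordinate has absolute value below \<open>n\<close>,
  so no entry outside this window is read.\<close>

lemma walk_cong:
  assumes "u \<in> Omega" "u' \<in> Omega" "v \<in> N"
    and "\<And>x. \<bar>x\<bar> < int n \<Longrightarrow> e x = u x" "\<And>x. \<bar>x\<bar> < int n \<Longrightarrow> e' x = u' x"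
  shows "(walk e e' ^^ n) (0, 0, v) = (walk u u' ^^ n) (0, 0, v)"
proof -
  have "(walk e e' ^^ j) (0, 0, v) = (walk u u' ^^ j) (0, 0, v) \<and>
    \<bar>fst ((walk u u' ^^ j) (0, 0, v))\<bar> \<le> int j \<and> \<bar>fst (snd ((walk u u' ^^ j) (0, 0, v)))\<bar> \<le> int j"
    if "j \<le> n" for j
    using that
  proof (induction j)
    case (Suc j)
    obtain x y a b where xy: "(walk u u' ^^ j) (0, 0, v) = (x, y, a, b)" by (metis prod.exhaust)
    have "(a, b) \<in> N" using walk_in_N[OF assms(1,2), of "(0, 0, v)" j] assms(3) xy by simp
    moreover have "e x = u x" "e' y = u' y" using assms(4,5) Suc xy by auto
    moreover have "\<bar>x\<bar> \<le> int j" "\<bar>y\<bar> \<le> int j" using Suc xy by auto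
    moreover have "(walk e e' ^^ j) (0, 0, v) = (x, y, a, b)" using Suc xy by simp
    ultimately show ?case
      using xy Omega_sign[OF assms(1), of x] Omega_sign[OF assms(2), of y]
      by (auto simp: walk_def Let_def N_iff)
  qed simp
  then show ?thesis by blast
qed

lemma open_cylinder:
  assumes "w \<in> Omega" "finite F"
  shows "openin Omega_top {e \<in> Omega. \<forall>x\<in>F. e x = w x}"
proof -
  have "{e \<in> Omega. \<forall>x\<in>F. e x = w x} = (\<Pi>\<^sub>E x\<in>UNIV. if x \<in> F then {w x} else {-1, 1})"
  proof (rule set_eqI)
    fix e
    show "e \<in> {e \<in> Omega. \<forall>x\<in>F. e x = w x} \<longleftrightarrow>
        e \<in> (\<Pi>\<^sub>E x\<in>UNIV. if x \<in> F then {w x} else {-1, 1})"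
      using assms(1) by (simp add: Omega_iff PiE_iff) (metis insertCI insertE singletonD)
  qed
  moreover have "finite {x. (if x \<in> F then {w x} else {-1, 1 :: int}) \<noteq> {-1, 1}}"
    by (rule finite_subset[OF _ assms(2)]) auto
  ultimately show ?thesis
    using assms(1) unfolding Omega_top_def
    by (auto intro!: product_topology_basis simp: Omega_iff)
qed

lemma open_contains_cylinder:
  assumes "openin Omega_top U" "w \<in> U"
  obtains F where "finite F" "\<And>e. e \<in> Omega \<Longrightarrow> (\<And>x. x \<in> F \<Longrightarrow> e x = w x) \<Longrightarrow> e \<in> U"
proof -
  obtain V where V: "finite {i. V i \<noteq> {-1, 1 :: int}}" "w \<in> PiE UNIV V" "PiE UNIV V \<subseteq> U"
    using assms unfolding Omega_top_def openin_product_topology_alt by fastforce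
  show thesis
  proof (rule that[OF V(1)])
    fix e assume e: "e \<in> Omega" "\<And>x. x \<in> {i. V i \<noteq> {-1, 1}} \<Longrightarrow> e x = w x"
    have "e x \<in> V x" for x
      using e(2)[of x] Omega_sign[OF e(1), of x] V(2) by (cases "V x = {-1, 1}") (auto simp: PiE_iff)
    then show "e \<in> U" using V(3) by (auto simp: PiE_iff)
  qed
qed

text \<open>If every sequence near \<open>w\<close> had period \<open>x \<noteq> 0\<close>, changing one remote entry would break this.\<close>

lemma locally_periodic_zero:
  assumes "openin Omega_top U" "w \<in> U" "w \<in> Omega"
    and period: "\<And>e. e \<in> U \<Longrightarrow> e \<in> Omega \<Longrightarrow> (\<And>z. \<bar>z\<bar> < int n \<Longrightarrow> e z = w z) \<Longrightarrow> (\<lambda>z. e (z + x)) = e"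
  shows "x = 0"
proof (rule ccontr)
  assume "x \<noteq> 0"
  obtain F where F: "finite F" "\<And>e. e \<in> Omega \<Longrightarrow> (\<And>x. x \<in> F \<Longrightarrow> e x = w x) \<Longrightarrow> e \<in> U"
    using open_contains_cylinder[OF assms(1,2)] by blast
  \<comment> \<open>The entry to flip lies outside \<open>F\<close>, to stay in \<open>U\<close>,
    and outside the window that determines the walk.\<close>
  have "finite (F \<union> {- int n..int n})" using F(1) by simp
  then obtain M where M: "M \<notin> F \<union> {- int n..int n}"
    using ex_new_if_finite infinite_UNIV_int by blast
  define e where "e = w(M := - w M)"
  have eO: "e \<in> Omega" using assms(3) by (auto simp: e_def Omega_iff)
  moreover have "e \<in> U" using M by (intro F(2) eO) (auto simp: e_def)
  moreover have "e z = w z" if "\<bar>z\<bar> < int n" for z using M that by (auto simp: e_def)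
  ultimately have "(\<lambda>z. e (z + x)) = e" by (intro period)
  then have "e (M + x) = e M" by metis
  \<comment> \<open>Comparing with the period of \<open>w\<close> itself: the flip changes the entry
    at \<open>M\<close> but not the one at \<open>M + x\<close>.\<close>
  moreover have "(\<lambda>z. w (z + x)) = w" using assms by (intro period) auto
  then have "w (M + x) = w M" by metis
  ultimately show False
    using \<open>x \<noteq> 0\<close> Omega_sign[OF assms(3), of M] by (auto simp: e_def)
qed

text \<open>Sequences agreeing on the window share the same displacement. If it vanishes, a cylinder
  is fixed; if a neighborhood is fixed, the displacement is a period of all nearby sequences and
  hence zero.\<close>

lemma locally_fixed_iff:
  assumes "w \<in> Omega" "w' \<in> Omega" "v \<in> N"
  shows "locally_fixed n (w, w', v) \<longleftrightarrow> (walk w w' ^^ n) (0, 0, v) = (0, 0, v)"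
proof
  have pow: "(Phi ^^ n) (e, e', v) = place e e' ((walk w w' ^^ n) (0, 0, v))"
    if "e \<in> Omega" "e' \<in> Omega" "\<And>x. \<bar>x\<bar> < int n \<Longrightarrow> e x = w x" "\<And>x. \<bar>x\<bar> < int n \<Longrightarrow> e' x = w' x"
    for e e'
    using Phi_pow_place[OF that(1,2), of n "(0, 0, v)"] walk_cong[OF assms that(3,4)]
    by (simp add: place_origin)
  {
    assume closed: "(walk w w' ^^ n) (0, 0, v) = (0, 0, v)"
    let ?U = "\<lambda>w :: seq. {e \<in> Omega. \<forall>x\<in>{- int n..int n}. e x = w x}"
    have "(Phi ^^ n) (e, e', v) = (e, e', v)" if "e \<in> ?U w" "e' \<in> ?U w'" for e e'
    proof -
      have "e x = w x" "e' x = w' x" if "\<bar>x\<bar> < int n" for x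
      proof -
        have "x \<in> {- int n..int n}" using that by auto
        then show "e x = w x" "e' x = w' x" using \<open>e \<in> ?U w\<close> \<open>e' \<in> ?U w'\<close> by blast+
      qed
      then show ?thesis using that pow[of e e'] by (simp add: closed place_origin)
    qed
    moreover have "openin Omega_top (?U w)" "openin Omega_top (?U w')" "w \<in> ?U w" "w' \<in> ?U w'"
      using assms open_cylinder by auto
    ultimately show "locally_fixed n (w, w', v)"
      unfolding locally_fixed.simps by blast
  }
  assume "locally_fixed n (w, w', v)"
  then obtain U U' where U: "openin Omega_top U" "w \<in> U" "openin Omega_top U'" "w' \<in> U'"
    and fixed: "\<And>e e'. e \<in> U \<Longrightarrow> e' \<in> U' \<Longrightarrow> (Phi ^^ n) (e, e', v) = (e, e', v)"
    by auto
  obtain x y v' where xy: "(walk w w' ^^ n) (0, 0, v) = (x, y, v')" by (metis prod.exhaust)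
  have translates: "(\<lambda>z. e (z + x)) = e \<and> (\<lambda>z. e' (z + y)) = e' \<and> v' = v"
    if "e \<in> U" "e' \<in> U'" "e \<in> Omega" "e' \<in> Omega"
      "\<And>x. \<bar>x\<bar> < int n \<Longrightarrow> e x = w x" "\<And>x. \<bar>x\<bar> < int n \<Longrightarrow> e' x = w' x" for e e'
    using fixed[OF that(1,2)] pow[OF that(3-6)] by (simp add: xy place_def)
  have "x = 0" by (rule locally_periodic_zero[OF U(1,2) assms(1)]) (use translates U assms in auto)
  moreover have "y = 0" by (rule locally_periodic_zero[OF U(3,4) assms(2)]) (use translates U assms in auto)
  moreover have "v' = v" using translates[of w w'] U assms by auto
  ultimately show "(walk w w' ^^ n) (0, 0, v) = (0, 0, v)" using xy by simp
qed

text \<open>Minimality of the period is automatic, since no walk closes in fewer than four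
  steps.\<close>

lemma P4_iff:
  assumes "w \<in> Omega" "w' \<in> Omega" "v \<in> N"
  shows "(w, w', v) \<in> P4 \<longleftrightarrow> (walk w w' ^^ 4) (0, 0, v) = (0, 0, v)"
  using assms walk_not_closed_below_four[OF assms(1,2), of "(0, 0, v)"]
  by (auto simp: P4_def stable_period_def X_def locally_fixed_iff simp del: locally_fixed.simps)

subsection \<open>Indexing the kept positions\<close>

lemma K_shift: "u \<in> Omega \<Longrightarrow> k \<in> K (\<lambda>n. u (n + x)) \<longleftrightarrow> k + x \<in> K u"
  by (simp add: K_iff shift_in_Omega algebra_simps)

lemma unbounded_collapsible_iff:
  "unbounded_collapsible u \<longleftrightarrow> (\<forall>z. (\<exists>k\<in>K u. z < k) \<and> (\<exists>k\<in>K u. k < z))"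
  by (auto simp: unbounded_collapsible_def bdd_above_def bdd_below_def not_le)

lemma unbounded_collapsible_shift:
  assumes "u \<in> Omega" "unbounded_collapsible u"
  shows "unbounded_collapsible (\<lambda>n. u (n + x))"
proof -
  have "(\<exists>k. k + x \<in> K u \<and> z < k) \<and> (\<exists>k. k + x \<in> K u \<and> k < z)" for z
  proof -
    obtain k l where "k \<in> K u" "z + x < k" "l \<in> K u" "l < z + x"
      using assms(2) unfolding unbounded_collapsible_iff by meson
    then show ?thesis
      by (intro conjI exI[of _ "k - x"] exI[of _ "l - x"]) auto
  qed
  then show ?thesis
    unfolding unbounded_collapsible_iff using K_shift[OF assms(1)] by blast
qed

lemma C_iff: "u \<in> C \<longleftrightarrow> u \<in> Omega \<and> unbounded_collapsible u \<and> 0 \<in> K u"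
  by (simp add: C_def zero_collapsible_def)

lemma shift_in_C_iff:
  assumes "u \<in> Omega" "unbounded_collapsible u"
  shows "(\<lambda>n. u (n + x)) \<in> C \<longleftrightarrow> x \<in> K u"
  using assms by (simp add: C_iff shift_in_Omega unbounded_collapsible_shift K_shift)

lemma place_in_R1_iff:
  assumes "u \<in> Omega" "u' \<in> Omega" "unbounded_collapsible u" "unbounded_collapsible u'"
  shows "place u u' p \<in> R1 \<longleftrightarrow> p \<in> kept u u'"
  using assms by (auto simp: place_def R1_def kept_def shift_in_C_iff split: prod.splits)

lemma int_set_enumeration:
  fixes A :: "int set"
  assumes "\<And>z. \<exists>k\<in>A. z < k" "\<And>z. \<exists>k\<in>A. k < z" "0 \<in> A"
  shows "\<exists>k :: int \<Rightarrow> int. strict_mono k \<and> range k = A \<and> k 0 = 0"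
proof -
  \<comment> \<open>Both halves contain 0 as their entry of index 0; the negative branch of
    \<open>k\<close> uses only positive indices of \<open>Q\<close>, so 0 is not listed
    twice.\<close>
  define P where "P = {n. int n \<in> A}"
  define Q where "Q = {n. - int n \<in> A}"
  have infP: "infinite P"
    unfolding infinite_nat_iff_unbounded
  proof
    fix m
    obtain k where "k \<in> A" "int m < k" using assms(1) by blast
    then show "\<exists>n>m. n \<in> P" by (intro exI[of _ "nat k"]) (auto simp: P_def)
  qed
  have infQ: "infinite Q"
    unfolding infinite_nat_iff_unbounded
  proof
    fix m
    obtain k where "k \<in> A" "k < - int m" using assms(2) by blast
    then show "\<exists>n>m. n \<in> Q" by (intro exI[of _ "nat (- k)"]) (auto simp: Q_def)
  qed
  have P0: "enumerate P 0 = 0" and Q0: "enumerate Q 0 = 0"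
    using assms(3) by (auto simp: enumerate_0 P_def Q_def intro!: Least_equality)
  have Ppos: "0 < enumerate P n" and Qpos: "0 < enumerate Q n" if "0 < n" for n
    using enumerate_mono[OF that infP] enumerate_mono[OF that infQ] P0 Q0 by auto
  define k where "k i = (if 0 \<le> i then int (enumerate P (nat i)) else - int (enumerate Q (nat (- i))))"
    for i :: int
  have "k i < k j" if "i < j" for i j
  proof -
    consider "0 \<le> i" | "i < 0" "0 \<le> j" | "j < 0" by linarith
    then show ?thesis
    proof cases
      case 1
      then show ?thesis using that enumerate_mono[OF _ infP, of "nat i" "nat j"] by (simp add: k_def)
    next
      case 2
      then show ?thesis using Qpos[of "nat (- i)"] by (simp add: k_def)
    next
      case 3
      then show ?thesis using that enumerate_mono[OF _ infQ, of "nat (- j)" "nat (- i)"]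
        by (simp add: k_def)
    qed
  qed
  then have "strict_mono k" by (simp add: strict_mono_def)
  moreover have "k i \<in> A" for i
    using enumerate_in_set[OF infP, of "nat i"] enumerate_in_set[OF infQ, of "nat (- i)"]
    by (auto simp: k_def P_def Q_def)
  moreover have "z \<in> range k" if "z \<in> A" for z
  proof (cases "0 \<le> z")
    case True
    then have "nat z \<in> P" using that by (simp add: P_def)
    from enumerate_Ex[OF infP this] obtain n where "enumerate P n = nat z" ..
    then have "k (int n) = z" using True by (simp add: k_def)
    then show ?thesis by (metis rangeI)
  next
    case False
    then have "nat (- z) \<in> Q" using that by (simp add: Q_def)
    from enumerate_Ex[OF infQ this] obtain n where n: "enumerate Q n = nat (- z)" ..
    have "n \<noteq> 0"
    proof
      assume "n = 0"
      then show False using False Q0 n by simp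
    qed
    then have "k (- int n) = z" using False n by (simp add: k_def)
    then show ?thesis by (metis rangeI)
  qed
  moreover have "k 0 = 0" by (simp add: k_def P0)
  ultimately show ?thesis by blast
qed

text \<open>Monotonicity leaves no value of \<open>k\<close> strictly between \<open>k i\<close> and
  \<open>k (i + a)\<close>, so the nearest range element in direction \<open>a\<close> is the
  latter.\<close>

lemma strict_mono_int_next:
  fixes k :: "int \<Rightarrow> int"
  assumes "strict_mono k" "a = 1 \<or> a = -1" "k i + a * int (Suc e) \<in> range k"
    and "\<And>d. d < e \<Longrightarrow> k i + a * int (Suc d) \<notin> range k"
  shows "k i + a * int (Suc e) = k (i + a)"
proof -
  have less: "k p < k q \<longleftrightarrow> p < q" for p q using assms(1) by (simp add: strict_mono_less)
  have le: "k p \<le> k q \<longleftrightarrow> p \<le> q" for p q using assms(1) by (simp add: strict_mono_less_eq)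
  obtain m where m: "k i + a * int (Suc e) = k m" using assms(3) by blast
  define d where "d = nat (a * (k (i + a) - k i) - 1)"
  have d: "k (i + a) = k i + a * int (Suc d)"
    using assms(2) less[of i "i + 1"] less[of "i - 1" i] by (auto simp: d_def)
  then have "\<not> d < e" using assms(4)[of d] by (metis rangeI)
  moreover have "\<not> e < d"
    using assms(2) m d less[of i m] less[of m i] le[of "i + 1" m] le[of m "i - 1"] by auto
  ultimately show ?thesis using d by (metis linorder_neqE_nat)
qed

text \<open>The range determines each neighboring value, so agreement spreads from 0 in both
  directions.\<close>

lemma strict_mono_int_unique:
  fixes k l :: "int \<Rightarrow> int"
  assumes "strict_mono k" "strict_mono l" "range k = range l" "k 0 = l 0"
  shows "k = l"
proof
  have step: "k (i + a) = l (i + a)" if "k i = l i" and a: "a = 1 \<or> a = -1" for i a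
  proof -
    define d where "d = nat (a * (k (i + a) - k i) - 1)"
    have d: "k (i + a) = k i + a * int (Suc d)"
      using a strict_monoD[OF assms(1), of i "i + 1"] strict_monoD[OF assms(1), of "i - 1" i]
      by (auto simp: d_def)
    have "k i + a * int (Suc j) \<notin> range k" if "j < d" for j
    proof
      assume "k i + a * int (Suc j) \<in> range k"
      then obtain m where m: "k i + a * int (Suc j) = k m" by blast
      have less: "k p < k q \<longleftrightarrow> p < q" for p q using assms(1) by (simp add: strict_mono_less)
      show False
        using a m d that less[of i m] less[of m i] less[of m "i + 1"] less[of "i - 1" m] by auto
    qed
    moreover have "k i + a * int (Suc d) \<in> range k" using d by (metis rangeI)
    ultimately have "l i + a * int (Suc d) = l (i + a)"
      using assms(2,3) a that(1) by (intro strict_mono_int_next) auto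
    then show ?thesis using d that by simp
  qed
  fix i
  show "k i = l i"
  proof (induction i rule: int_induct[where k = 0])
    case (step2 i)
    then show ?case using step[of i "-1"] by simp
  qed (use step assms(4) in auto)
qed

lemma K_index_eqI:
  assumes "strict_mono k" "range k = K u" "k 0 = 0"
  shows "K_index u = k"
  unfolding K_index_def using assms strict_mono_int_unique by (intro the_equality) auto

lemma K_index_enumerates:
  assumes "u \<in> C"
  shows "strict_mono (K_index u)" "range (K_index u) = K u" "K_index u 0 = 0"
proof -
  have "\<exists>k\<in>K u. z < k" "\<exists>k\<in>K u. k < z" "0 \<in> K u" for z
    using assms by (auto simp: C_iff unbounded_collapsible_iff)
  from int_set_enumeration[OF this] obtain k :: "int \<Rightarrow> int" where "strict_mono k" "range k = K u" "k 0 = 0"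
    by blast
  then show "strict_mono (K_index u)" "range (K_index u) = K u" "K_index u 0 = 0"
    using K_index_eqI by auto
qed

text \<open>Recentering at the kept position \<open>K_index u i\<close> merely renumbers the kept
  positions so that it gets index 0.\<close>

lemma collapse_shift:
  assumes "u \<in> C"
  shows "collapse (\<lambda>n. u (n + K_index u i)) = (\<lambda>n. collapse u (n + i))"
proof -
  note k = K_index_enumerates[OF assms]
  have u: "u \<in> Omega" using assms by (simp add: C_iff)
  have "K_index (\<lambda>n. u (n + K_index u i)) = (\<lambda>j. K_index u (j + i) - K_index u i)"
  proof (rule K_index_eqI)
    show "strict_mono (\<lambda>j. K_index u (j + i) - K_index u i)"
      using k(1) by (simp add: strict_mono_def)
    show "range (\<lambda>j. K_index u (j + i) - K_index u i) = K (\<lambda>n. u (n + K_index u i))"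
    proof (intro set_eqI iffI)
      fix z assume "z \<in> K (\<lambda>n. u (n + K_index u i))"
      then have "z + K_index u i \<in> range (K_index u)" using k(2) u by (simp add: K_shift)
      then obtain j where "z + K_index u i = K_index u j" by blast
      then show "z \<in> range (\<lambda>j. K_index u (j + i) - K_index u i)"
        by (intro image_eqI[of _ _ "j - i"]) auto
    next
      fix z assume "z \<in> range (\<lambda>j. K_index u (j + i) - K_index u i)"
      then show "z \<in> K (\<lambda>n. u (n + K_index u i))"
        using k(2) u by (auto simp: K_shift)
    qed
  qed simp
  then show ?thesis by (simp add: collapse_def)
qed

lemma collapse_in_Omega: "u \<in> Omega \<Longrightarrow> collapse u \<in> Omega"
  by (auto simp: collapse_def Omega_iff)

subsection \<open>Renormalization\<close>

text \<open>Embeds the lattice of the collapsed sequences onto the kept positions of the original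
  one.\<close>

definition expand :: "seq \<Rightarrow> seq \<Rightarrow> int \<times> int \<times> int \<times> int \<Rightarrow> int \<times> int \<times> int \<times> int" where
  "expand u u' = (\<lambda>(i, j, v). (K_index u i, K_index u' j, v))"

lemma expand_origin: "u \<in> C \<Longrightarrow> u' \<in> C \<Longrightarrow> expand u u' (0, 0, v) = (0, 0, v)"
  by (simp add: expand_def K_index_enumerates)

lemma expand_inject: "u \<in> C \<Longrightarrow> u' \<in> C \<Longrightarrow> expand u u' p = expand u u' q \<longleftrightarrow> p = q"
  by (auto simp: expand_def strict_mono_eq K_index_enumerates split: prod.splits)

lemma rho_place_expand:
  assumes "u \<in> C" "u' \<in> C"
  shows "rho (place u u' (expand u u' q)) = place (collapse u) (collapse u') q"
  using assms by (auto simp: place_def expand_def collapse_shift split: prod.splits)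

lemma first_return_transpose:
  "first_return (walk u' u) (kept u' u) (transpose p) = transpose (first_return (walk u u') (kept u u') p)"
  by (simp add: first_return_def walk_transpose_pow transpose_kept)

text \<open>The first return ends at the nearest kept column, whose index differs by
  \<open>a\<close>; this same \<open>a\<close> is the turn computed from the collapsed
  signs.\<close>

lemma first_return_expand_column:
  assumes "u \<in> C" "u' \<in> C" "b = 1 \<or> b = -1"
  shows "first_return (walk u u') (kept u u') (expand u u' (i, j, 0, b)) =
    expand u u' (walk (collapse u) (collapse u') (i, j, 0, b))"
proof -
  note k = K_index_enumerates[OF assms(1)] and k' = K_index_enumerates[OF assms(2)]
  have O: "u \<in> Omega" "u' \<in> Omega" "unbounded_collapsible u" using assms by (auto simp: C_iff)
  let ?x = "K_index u i" and ?y = "K_index u' j"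
  define a where "a = u ?x * u' ?y * b"
  have a: "a = 1 \<or> a = -1"
    using assms(3) Omega_sign[OF O(1), of ?x] Omega_sign[OF O(2), of ?y] by (auto simp: a_def)
  have "?x \<in> K u" "?y \<in> K u'" using k(2) k'(2) by auto
  then obtain e where e: "?x + a * int (Suc e) \<in> K u" "\<And>d. d < e \<Longrightarrow> ?x + a * int (Suc d) \<notin> K u"
    "first_return (walk u u') (kept u u') (?x, ?y, 0, b) = (?x + a * int (Suc e), ?y, a, 0)"
    using first_return_step[OF O _ _ assms(3) a_def] by blast
  have "?x + a * int (Suc e) = K_index u (i + a)"
    by (rule strict_mono_int_next[OF k(1) a]) (use e k(2) in auto)
  then show ?thesis
    using e(3) by (simp add: expand_def walk_def Let_def collapse_def a_def)
qed

lemma expand_transpose: "expand u' u (transpose q) = transpose (expand u u' q)"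
  by (auto simp: expand_def transpose_def split: prod.splits)

lemma first_return_expand:
  assumes "u \<in> C" "u' \<in> C" "snd (snd q) \<in> N"
  shows "first_return (walk u u') (kept u u') (expand u u' q) =
    expand u u' (walk (collapse u) (collapse u') q)"
proof -
  obtain i j a b where q: "q = (i, j, a, b)" by (metis prod.exhaust)
  consider "a = 0" "b = 1 \<or> b = -1" | "b = 0" "a = 1 \<or> a = -1"
    using assms(3) q by (auto simp: N_iff)
  then show ?thesis
  proof cases
    case 1
    then show ?thesis using first_return_expand_column assms q by blast
  next
    case 2
    then have t: "transpose q = (j, i, 0, a)" by (simp add: q transpose_def)
    have "first_return (walk u' u) (kept u' u) (expand u' u (transpose q)) =
        expand u' u (walk (collapse u') (collapse u) (transpose q))"
      unfolding t using first_return_expand_column[OF assms(2,1) 2(2)] by blast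
    then show ?thesis
      by (simp add: expand_transpose first_return_transpose walk_transpose transpose_inject)
  qed
qed

lemma first_return_pow_expand:
  assumes "u \<in> C" "u' \<in> C" "snd (snd q) \<in> N"
  shows "(first_return (walk u u') (kept u u') ^^ m) (expand u u' q) =
    expand u u' ((walk (collapse u) (collapse u') ^^ m) q)"
proof (induction m)
  case (Suc m)
  have "snd (snd ((walk (collapse u) (collapse u') ^^ m) q)) \<in> N"
    using assms by (intro walk_in_N collapse_in_Omega) (auto simp: C_iff)
  then show ?case using Suc first_return_expand assms by simp
qed simp

lemma Phi_R_place:
  assumes "u \<in> Omega" "u' \<in> Omega" "unbounded_collapsible u" "unbounded_collapsible u'"
  shows "Phi_R (place u u' p) = place u u' (first_return (walk u u') (kept u u') p)"
  using assms by (simp add: Phi_R_def first_return_def Phi_pow_place place_in_R1_iff)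

lemma Phi_R_renormalizes:
  assumes "x \<in> R1"
  shows "rho (Phi_R x) = Phi (rho x)"
proof -
  obtain u u' v where x: "x = (u, u', v)" and C: "u \<in> C" "u' \<in> C" and v: "v \<in> N"
    using assms by (auto simp: R1_def)
  have O: "u \<in> Omega" "u' \<in> Omega" "unbounded_collapsible u" "unbounded_collapsible u'"
    using C by (auto simp: C_iff)
  let ?o = "(0, 0, v) :: int \<times> int \<times> int \<times> int"
  have "Phi_R x = place u u' (expand u u' (walk (collapse u) (collapse u') ?o))"
    using Phi_R_place[OF O, of ?o] first_return_expand[OF C, of ?o] v
    by (simp add: x place_origin expand_origin[OF C])
  then have "rho (Phi_R x) = place (collapse u) (collapse u') (walk (collapse u) (collapse u') ?o)"
    using rho_place_expand[OF C] by simp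
  also have "\<dots> = Phi (place (collapse u) (collapse u') ?o)"
    using O by (intro Phi_place[symmetric] collapse_in_Omega)
  finally show ?thesis by (simp add: x place_origin)
qed

text \<open>A period of \<open>n\<close> steps contains \<open>m\<close> first returns, and these
  are \<open>m\<close> steps of the collapsed walk. Equality would give a closed orbit inside
  \<open>kept\<close>.\<close>

lemma stable_period_shrinks:
  assumes "x \<in> R1" "stable_period x n"
  shows "\<exists>m<n. stable_period (rho x) m"
proof -
  obtain u u' v where x: "x = (u, u', v)" and C: "u \<in> C" "u' \<in> C" and v: "v \<in> N"
    using assms by (auto simp: R1_def)
  have O: "u \<in> Omega" "u' \<in> Omega" using C by (auto simp: C_iff)
  then have cO: "collapse u \<in> Omega" "collapse u' \<in> Omega" by (auto intro: collapse_in_Omega)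
  let ?o = "(0, 0, v) :: int \<times> int \<times> int \<times> int"
  have n: "0 < n" "(walk u u' ^^ n) ?o = ?o"
    using assms(2) locally_fixed_iff[OF O v] by (auto simp: stable_period_def x simp del: locally_fixed.simps)
  have o: "?o \<in> kept u u'" using C v by (auto simp: kept_def C_iff)
  obtain m where m: "0 < m" "m \<le> n" "(first_return (walk u u') (kept u u') ^^ m) ?o = ?o"
    "m = n \<Longrightarrow> \<forall>j\<le>n. (walk u u' ^^ j) ?o \<in> kept u u'"
    using first_return_count[of ?o "kept u u'" n "walk u u'"] n o by auto
  have "m \<noteq> n"
  proof
    assume "m = n"
    \<comment> \<open>One full period inside \<open>kept\<close> gives the whole orbit, reducing
      \<open>j\<close> modulo \<open>n\<close>.\<close>
    then have "(walk u u' ^^ j) ?o \<in> kept u u'" for j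
      using m(4) funpow_mod_eq[OF n(2), of j] n(1) by (metis mod_le_divisor)
    then show False using kept_orbit_not_closed[OF O n(1)] n(2) by blast
  qed
  have "(walk (collapse u) (collapse u') ^^ m) ?o = ?o"
    using m(3) first_return_pow_expand[OF C, of ?o m] v expand_inject[OF C, of _ ?o]
    by (metis expand_origin[OF C] snd_conv)
  then have "locally_fixed m (rho x)"
    using locally_fixed_iff[OF cO v] by (simp add: x del: locally_fixed.simps)
  \<comment> \<open>\<open>m\<close> closes the collapsed walk but need not be its least
    period.\<close>
  define l where "l = (LEAST l. 0 < l \<and> locally_fixed l (rho x))"
  have "0 < l \<and> locally_fixed l (rho x)"
    unfolding l_def by (rule LeastI[of _ m]) (use m \<open>locally_fixed m (rho x)\<close> in auto)
  moreover have "l \<le> m"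
    unfolding l_def by (rule Least_le) (use m \<open>locally_fixed m (rho x)\<close> in auto)
  moreover have "\<not> locally_fixed j (rho x)" if "0 < j" "j < l" for j
    using not_less_Least[of j "\<lambda>l. 0 < l \<and> locally_fixed l (rho x)"] that by (auto simp: l_def)
  moreover have "rho x \<in> X" using cO v by (simp add: x X_def)
  ultimately show ?thesis
    using \<open>m \<noteq> n\<close> m(2) by (intro exI[of _ l]) (auto simp: stable_period_def)
qed

section \<open>Returns to \<open>R1\<close> in both time directions\<close>

lemma R1_return:
  assumes "x \<in> X" "x \<notin> P4" "x \<notin> NUC"
  shows "\<exists>n>0. (Phi ^^ n) x \<in> R1" "\<exists>n>0. \<exists>z\<in>R1. (Phi ^^ n) z = x"
proof -
  obtain u u' v where x: "x = (u, u', v)" and O: "u \<in> Omega" "u' \<in> Omega"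
    "unbounded_collapsible u" "unbounded_collapsible u'" and v: "v \<in> N"
    using assms(1,3) by (auto simp: X_def NUC_def)
  let ?o = "(0, 0, v) :: int \<times> int \<times> int \<times> int"
  have np: "(walk u u' ^^ 4) ?o \<noteq> ?o" using assms(2) P4_iff[OF O(1,2) v] x by simp
  have xp: "x = place u u' ?o" by (simp add: x place_origin)
  show "\<exists>n>0. (Phi ^^ n) x \<in> R1"
    unfolding xp Phi_pow_place[OF O(1,2)] place_in_R1_iff[OF O]
    using reaches_kept[OF O, of ?o] np v by auto
  obtain n q where "0 < n" "q \<in> kept u u'" "(walk u u' ^^ n) q = ?o"
    using reached_from_kept[OF O, of ?o] np v by auto
  then show "\<exists>n>0. \<exists>z\<in>R1. (Phi ^^ n) z = x"
    using Phi_pow_place[OF O(1,2), of n q] place_in_R1_iff[OF O, of q] by (metis xp)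
qed

lemma P4_disjoint_R1: "P4 \<inter> R1 = {}"
proof -
  have False if P4: "x \<in> P4" and R1: "x \<in> R1" for x
  proof -
    obtain u u' v where x: "x = (u, u', v)" and C: "u \<in> C" "u' \<in> C" and v: "v \<in> N"
      using R1 by (auto simp: R1_def)
    have "u \<in> Omega" "u' \<in> Omega" "(0, 0, v) \<in> kept u u'" using C v by (auto simp: C_iff kept_def)
    then show False using kept_not_four_periodic P4 P4_iff v x by blast
  qed
  then show ?thesis by blast
qed

theorem theorem19:
  "P4 \<inter> R1 = {} \<and>
   (\<forall>x \<in> X - (P4 \<union> NUC).
      \<exists>m n :: int. m < 0 \<and> 0 < n \<and> Phi_pow m x \<in> R1 \<and> Phi_pow n x \<in> R1) \<and>
   (\<forall>x \<in> R1. \<exists>n > 0. (Phi ^^ n) x \<in> R1) \<and>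
   bij_betw Phi_R R1 R1 \<and>
   (\<forall>x \<in> R1. rho (Phi_R x) = Phi (rho x)) \<and>
   (\<forall>x \<in> R1. \<forall>n > 4. stable_period x n \<longrightarrow> (\<exists>m < n. stable_period (rho x) m))"
proof -
  have R1X: "R1 \<subseteq> X" by (auto simp: R1_def X_def C_iff)
  have R1: "x \<in> X" "x \<notin> P4" "x \<notin> NUC" if "x \<in> R1" for x
    using that P4_disjoint_R1 R1X by (auto simp: R1_def NUC_def C_iff)
  have "\<exists>m n :: int. m < 0 \<and> 0 < n \<and> Phi_pow m x \<in> R1 \<and> Phi_pow n x \<in> R1"
    if x: "x \<in> X - (P4 \<union> NUC)" for x
  proof -
    obtain n where n: "0 < n" "(Phi ^^ n) x \<in> R1" using R1_return x by blast
    obtain m z where m: "0 < m" "z \<in> R1" "(Phi ^^ m) z = x" using R1_return(2)[of x] x by blast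
    \<comment> \<open>Negative powers are iterates of \<open>inv_into X Phi\<close>; undoing
      \<open>m\<close> steps recovers the past visit \<open>z\<close>.\<close>
    have inverse: "(inv_into X Phi ^^ i) ((Phi ^^ i) z) = z" if "z \<in> X" for i z
      using that
    proof (induction i arbitrary: z)
      case (Suc i)
      have "Phi z \<in> X" using bij_betw_Phi Suc.prems by (auto simp: bij_betw_def)
      have "(inv_into X Phi ^^ Suc i) ((Phi ^^ Suc i) z) =
          inv_into X Phi ((inv_into X Phi ^^ i) ((Phi ^^ i) (Phi z)))"
        by (simp add: funpow_swap1 del: Phi.simps)
      also have "\<dots> = inv_into X Phi (Phi z)" using Suc.IH[OF \<open>Phi z \<in> X\<close>] by (rule arg_cong)
      also have "\<dots> = z" using bij_betw_Phi Suc.prems by (simp add: bij_betw_def del: Phi.simps)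
      finally show ?case .
    qed simp
    have "Phi_pow (- int m) x \<in> R1"
      using inverse[of z m] m R1X by (auto simp: int_iter_def)
    moreover have "Phi_pow (int n) x \<in> R1" using n by (simp add: int_iter_def)
    ultimately show ?thesis
      using n m by (intro exI[of _ "- int m"] exI[of _ "int n"]) auto
  qed
  moreover have "bij_betw Phi_R R1 R1"
  proof -
    have "Phi_R = first_return Phi R1" by (simp add: fun_eq_iff Phi_R_def first_return_def)
    moreover have "bij_betw (first_return Phi R1) R1 R1"
      by (rule bij_betw_first_return[OF bij_betw_Phi R1X]) (use R1_return R1 in blast)+
    ultimately show ?thesis by simp
  qed
  moreover have "\<exists>n>0. (Phi ^^ n) x \<in> R1" if "x \<in> R1" for x
    using R1_return(1) R1[OF that] by blast
  ultimately show ?thesis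
    using P4_disjoint_R1 Phi_R_renormalizes stable_period_shrinks by blast
qed

end
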